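(* Let $A\in\mathbb{R}^{n\times n}$ be nonsingular, $u,v,b\in\mathbb{R}^n$, $B:=A+uv^T$ nonsingular, and let $x$ be the exact solution of $Bx=b$. Assume that the linear systems $Ay=b$, $Az=u$ and $Aw=\widehat d$ in the modified Sherman--Morrison algorithm (MSM) are solved normwise backward stably with stability constant $c_s$. Define $$\widetilde c_3:=(n+c_s+3)\frac{\|A\|+\|u\|\|v\|}{\|B\|},\quad \widetilde c_4:=(2n+2c_s+4)\frac{\|A\|+\|u\|\|v\|}{\|B\|},\quad \widetilde c_5:=\frac{c_s\|u\|}{\|B\|},$$ $$c_3:=\frac{1+c_s+\widetilde c_3}{1-\epsilon_M\widetilde c_3\kappa(B)},\quad c_4:=\frac{\widetilde c_4}{1-\epsilon_M\widetilde c_3\kappa(B)},\quad c_5:=\frac{\widetilde c_5}{1-\epsilon_M\widetilde c_3\kappa(B)},$$ and assume that $\epsilon_M\widetilde c_3\kappa(B)<1$. If $\widehat x$ is computed by MSM in floating point arithmetic with unit roundoff $\epsilon_M$, and $\widehat p,\widehat\theta,\widehat\theta_1$ are the computed values of $p,\theta,\theta_1$ in that algorithm, then $$\|\widehat x-x\|\le\frac{\epsilon_M\kappa(B)}{1-c_3\epsilon_M\kappa(B)}\Big(c_3\|\widehat x\|+c_4\|\widehat p\|+c_5\big(|\widehat\theta|+|\widehat\theta_1|\big)\Big).$$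
   Context: Norms: $\|\cdot\|$ is the Euclidean vector norm and the induced matrix 2-norm; $\kappa(B)=\|B\|\,\|B^{-1}\|$. Algorithm MSM (for $(A+uv^T)x=b$): (1) solve $Ay=b$ for $y$; (2) solve $Az=u$ for $z$; (3) compute $\alpha=v^Ty$, $\beta=1+v^Tz$, $\theta=\alpha/\beta$; (4) compute $d=b-u\theta$; (5) solve $Aw=d$ for $w$; (6) compute $\theta_1=(v^Tw-\theta)/\beta$; (7) compute $p=z\theta_1$; (8) output $x=w-p$. Hats denote the quantities actually computed in floating point arithmetic. The computed $\widehat\beta$ is nonzero. Floating point model: $\epsilon_M$ is the unit roundoff, $n\epsilon_M<1$, $\gamma_n=n\epsilon_M/(1-n\epsilon_M)$. Every scalar operation satisfies $\mathrm{fl}(a\circ b)=(a\circ b)(1+\delta)$, $|\delta|\le\epsilon_M$, $\circ\in\{+,-,\times,/\}$ (vector operations being performed entrywise). A computed inner product satisfies $\mathrm{fl}(v^Tw)=v^T(I+D)w$ with $D$ diagonal and $|D|\le\gamma_n I$ entrywise. Normwise backward stable solve with (modest) constant $c_s$: for a right-hand side $g$ (in step (5) the computed vector $\widehat d$), the computed solution $\widehat s$ of $As=g$ satisfies $(A+\delta A)\widehat s=g+\delta g$ for some $\delta A,\delta g$ (which may differ from solve to solve) with $\|\delta A\|\le c_s\epsilon_M\|A\|$ and $\|\delta g\|\le c_s\epsilon_M\|g\|$.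
   Formalization: The formal theorem adds the assumption c_3 ε_M κ(B) < 1 (positive denominator in the bound); without it the bound fails, e.g. n=1, A=b=1, u=v=0, c_s=0, ε_M=1/5, exact operations, where the right side is negative and the left side is 0. *)

theory Defs
  imports "HOL-Analysis.Analysis"
begin

text \<open>
  The operator 2-norm; note that the type-class \<open>norm\<close> on \<open>real ^ 'n ^ 'm\<close> is the Frobenius norm.
\<close>

definition mnorm2 :: "real ^ 'n ^ 'm \<Rightarrow> real" where
  "mnorm2 A = onorm (\<lambda>x. A *v x)"

definition kappa2 :: "real ^ 'n ^ 'n \<Rightarrow> real" where
  "kappa2 B = mnorm2 B * mnorm2 (matrix_inv B)"

definition outer :: "real ^ 'm \<Rightarrow> real ^ 'n \<Rightarrow> real ^ 'n ^ 'm" where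
  "outer u v = (\<chi> i j. u $ i * v $ j)"

definition fp_gamma :: "real \<Rightarrow> nat \<Rightarrow> real" where
  "fp_gamma eps n = real n * eps / (1 - real n * eps)"

text \<open>
  Floating point operations are modelled relationally: \<open>fl eps r c\<close> says that \<open>c\<close> is an
  admissible computed value of a single scalar operation whose exact result is \<open>r\<close>. The rounding
  error may therefore differ from one operation (and one vector entry) to the next.
\<close>

definition fl :: "real \<Rightarrow> real \<Rightarrow> real \<Rightarrow> bool" where
  "fl eps r c \<longleftrightarrow> (\<exists>\<delta>. \<bar>\<delta>\<bar> \<le> eps \<and> c = r * (1 + \<delta>))"

definition fl_vec :: "real \<Rightarrow> real ^ 'n \<Rightarrow> real ^ 'n \<Rightarrow> bool" where
  "fl_vec eps r c \<longleftrightarrow> (\<forall>i. fl eps (r $ i) (c $ i))"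

text \<open>The entrywise bound \<open>\<bar>D\<bar> \<le> \<gamma>\<^sub>n I\<close> forces \<open>D\<close> to be diagonal.\<close>

definition fl_inner :: "real \<Rightarrow> real ^ 'n \<Rightarrow> real ^ 'n \<Rightarrow> real \<Rightarrow> bool" where
  "fl_inner eps v w c \<longleftrightarrow>
     (\<exists>D :: real ^ 'n ^ 'n.
        (\<forall>i j. \<bar>D $ i $ j\<bar> \<le> (fp_gamma eps CARD('n) *\<^sub>R mat 1 :: real ^ 'n ^ 'n) $ i $ j) \<and>
        c = v \<bullet> ((mat 1 + D) *v w))"

definition backward_stable_solution ::
  "real \<Rightarrow> real \<Rightarrow> real ^ 'n ^ 'n \<Rightarrow> real ^ 'n \<Rightarrow> real ^ 'n \<Rightarrow> bool" where
  "backward_stable_solution cs eps A g s \<longleftrightarrow>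
     (\<exists>\<delta>A \<delta>g. (A + \<delta>A) *v s = g + \<delta>g \<and>
        mnorm2 \<delta>A \<le> cs * eps * mnorm2 A \<and> norm \<delta>g \<le> cs * eps * norm g)"

text \<open>
  All arguments from \<open>y\<close> on are computed quantities. The existentially quantified variables are the
  computed intermediate results of compound expressions: \<open>vz\<close> of \<open>v\<^sup>T z\<close> and \<open>vw\<close> of \<open>v\<^sup>T w\<close>,
  \<open>ut\<close> of \<open>u \<theta>\<close>, and \<open>r\<close> of \<open>v\<^sup>T w - \<theta>\<close>. Nonvanishing of \<open>\<beta>\<close> is not part of the predicate.
\<close>

definition msm_computed ::
  "real \<Rightarrow> real \<Rightarrow> real ^ 'n ^ 'n \<Rightarrow> real ^ 'n \<Rightarrow> real ^ 'n \<Rightarrow> real ^ 'n \<Rightarrow>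
   real ^ 'n \<Rightarrow> real ^ 'n \<Rightarrow> real \<Rightarrow> real \<Rightarrow> real \<Rightarrow> real ^ 'n \<Rightarrow> real ^ 'n \<Rightarrow> real \<Rightarrow>
   real ^ 'n \<Rightarrow> real ^ 'n \<Rightarrow> bool" where
  "msm_computed cs eps A u v b y z \<alpha> \<beta> \<theta> d w \<theta>1 p x \<longleftrightarrow>
     backward_stable_solution cs eps A b y \<and>
     backward_stable_solution cs eps A u z \<and>
     fl_inner eps v y \<alpha> \<and>
     (\<exists>vz. fl_inner eps v z vz \<and> fl eps (1 + vz) \<beta>) \<and>
     fl eps (\<alpha> / \<beta>) \<theta> \<and>
     (\<exists>ut. fl_vec eps (\<theta> *\<^sub>R u) ut \<and> fl_vec eps (b - ut) d) \<and>
     backward_stable_solution cs eps A d w \<and>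
     (\<exists>vw r. fl_inner eps v w vw \<and> fl eps (vw - \<theta>) r \<and> fl eps (r / \<beta>) \<theta>1) \<and>
     fl_vec eps (\<theta>1 *\<^sub>R z) p \<and>
     fl_vec eps (w - p) x"

end

theory Submission
  imports Defs
begin

text \<open>
  Substituting the backward errors of the solves and the rounding errors of the remaining operations
  into \<open>B xh - b\<close> gives a sum of error terms. The terms in \<open>\<theta> u\<close> and
  \<open>\<theta>\<^sub>1 (1 + v\<^sup>T z) u\<close> that do not carry a factor \<open>c\<^sub>s\<close> are rewritten by \<open>\<theta> u \<approx> b - A w\<close> and
  \<open>\<theta>\<^sub>1 (1 + v\<^sup>T z) u \<approx> B p\<close>, so that only \<open>b\<close>, \<open>xh\<close> and \<open>p\<close> remain; the first order part is then
  bounded by the constants with a tilde. With \<open>t = \<epsilon> c3t \<kappa>(B)\<close>, all higher order products together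
  contribute at most a factor \<open>1 / (1 - 2t)\<close>. This is exactly the room left by the claimed bound,
  whose two nested denominators combine to \<open>1 - 2t - \<epsilon> \<kappa>(B) (1 + c\<^sub>s)\<close>.
\<close>

section \<open>The operator 2-norm, rank-one updates and the condition number\<close>

lemma norm_matrix_vector_le_mnorm2:
  fixes A :: "real ^ 'n ^ 'm"
  shows "norm (A *v x) \<le> mnorm2 A * norm x"
  unfolding mnorm2_def by (rule onorm) (rule matrix_vector_mul_bounded_linear)

lemma mnorm2_nonneg:
  fixes A :: "real ^ 'n ^ 'm"
  shows "0 \<le> mnorm2 A"
  unfolding mnorm2_def by (rule onorm_pos_le) (rule matrix_vector_mul_bounded_linear)

lemma outer_vector_mult:
  fixes u :: "real ^ 'm" and v x :: "real ^ 'n"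
  shows "outer u v *v x = (v \<bullet> x) *\<^sub>R u"
  by (simp add: vec_eq_iff outer_def matrix_vector_mult_def inner_vec_def sum_distrib_left
      sum_distrib_right mult_ac)

text \<open>Cauchy-Schwarz handles the rank-one part. The bound serves twice: it estimates
  \<open>B\<close> applied to error vectors in the residual, and it makes the quotient
  \<open>S / mnorm2 B\<close> in the constants at least 1.\<close>

lemma mnorm2_add_outer_le:
  fixes A :: "real ^ 'n ^ 'm"
  shows "mnorm2 (A + outer u v) \<le> mnorm2 A + norm u * norm v"
  unfolding mnorm2_def[of "A + outer u v"]
proof (rule onorm_le)
  fix x
  have "norm ((A + outer u v) *v x) \<le> norm (A *v x) + norm ((v \<bullet> x) *\<^sub>R u)"
    by (simp add: matrix_vector_mult_add_rdistrib outer_vector_mult norm_triangle_ineq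
        del: norm_scaleR)
  also have "\<dots> \<le> mnorm2 A * norm x + norm v * norm x * norm u"
    by (auto intro!: add_mono mult_right_mono norm_matrix_vector_le_mnorm2 Cauchy_Schwarz_ineq2)
  finally show "norm ((A + outer u v) *v x) \<le> (mnorm2 A + norm u * norm v) * norm x"
    by (simp add: algebra_simps)
qed

lemma matrix_inv_mult_vector:
  fixes B :: "real ^ 'n ^ 'n"
  assumes "invertible B"
  shows "B *v (matrix_inv B *v x) = x" "matrix_inv B *v (B *v x) = x"
  using assms someI_ex[of "\<lambda>A'. B ** A' = mat 1 \<and> A' ** B = mat 1"]
  by (simp_all add: matrix_vector_mul_assoc matrix_inv_def invertible_def)

text \<open>A unit vector is \<open>B\<close> applied to its preimage, so the two operator norms
  multiply to at least 1. Besides \<open>eps \<le> eps * kappa2 B\<close>, this yields positivity of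
  the operator norm of an invertible matrix.\<close>

lemma kappa2_ge_1:
  fixes B :: "real ^ 'n ^ 'n"
  assumes "invertible B"
  shows "1 \<le> kappa2 B"
proof -
  obtain x :: "real ^ 'n" where x: "norm x = 1"
    using vector_choose_size[of 1] by auto
  have "B *v (matrix_inv B *v x) = x"
    using assms by (rule matrix_inv_mult_vector)
  then have "1 \<le> mnorm2 B * norm (matrix_inv B *v x)"
    using norm_matrix_vector_le_mnorm2[of B "matrix_inv B *v x"] x by simp
  also have "\<dots> \<le> mnorm2 B * (mnorm2 (matrix_inv B) * norm x)"
    by (intro mult_left_mono norm_matrix_vector_le_mnorm2 mnorm2_nonneg)
  finally show ?thesis
    by (simp add: kappa2_def x)
qed

section \<open>Rounding errors of vector operations, inner products and quotients\<close>

lemma fl_vec_error: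
  assumes "fl_vec eps r c" "0 \<le> eps"
  shows "norm (c - r) \<le> eps * norm r"
proof -
  have "norm (c - r) \<le> norm (eps *\<^sub>R r)"
  proof (rule norm_le_componentwise_cart)
    fix i
    obtain \<delta> where "\<bar>\<delta>\<bar> \<le> eps" "c $ i = r $ i * (1 + \<delta>)"
      using assms by (auto simp: fl_vec_def fl_def)
    then show "norm ((c - r) $ i) \<le> norm ((eps *\<^sub>R r) $ i)"
      using assms by (simp add: algebra_simps abs_mult mult_right_mono)
  qed
  then show ?thesis
    using assms by simp
qed

text \<open>The triangle inequality reverses the rounding estimate. This direction is needed because
  the final bound is expressed in computed quantities.\<close>

lemma fl_vec_norm_le:
  assumes "fl_vec eps r c" "0 \<le> eps" "eps < 1"
  shows "norm r \<le> norm c / (1 - eps)"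
  using fl_vec_error[OF assms(1,2)] norm_triangle_ineq2[of r c] assms(3)
  by (simp add: field_simps norm_minus_commute)

text \<open>Off-diagonal entries of \<open>D\<close> vanish, so \<open>D\<close> applied to
  \<open>w\<close> is entrywise at most \<open>fp_gamma\<close> times \<open>w\<close> in absolute
  value; Cauchy-Schwarz does the rest.\<close>

lemma fl_inner_error:
  fixes v w :: "real ^ 'n"
  assumes "fl_inner eps v w c" "0 \<le> eps" "real CARD('n) * eps < 1"
  shows "\<bar>c - v \<bullet> w\<bar> \<le> fp_gamma eps CARD('n) * (norm v * norm w)"
proof -
  let ?g = "fp_gamma eps CARD('n)"
  have g: "0 \<le> ?g"
    using assms by (simp add: fp_gamma_def)
  obtain D :: "real ^ 'n ^ 'n" where D: "\<And>i j. \<bar>D $ i $ j\<bar> \<le> (?g *\<^sub>R mat 1 :: real ^ 'n ^ 'n) $ i $ j"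
    and c: "c = v \<bullet> ((mat 1 + D) *v w)"
    using assms by (auto simp: fl_inner_def)
  have "norm (D *v w) \<le> norm (?g *\<^sub>R w)"
  proof (rule norm_le_componentwise_cart)
    fix i
    have "D $ i $ j = 0" if "j \<noteq> i" for j
      using D[of i j] that by (simp add: mat_def)
    then have "(D *v w) $ i = D $ i $ i * w $ i"
      by (simp add: matrix_vector_mult_def sum.remove[of UNIV i])
    then show "norm ((D *v w) $ i) \<le> norm ((?g *\<^sub>R w) $ i)"
      using D[of i i] g by (simp add: mat_def abs_mult mult_right_mono)
  qed
  then have le: "norm v * norm (D *v w) \<le> norm v * norm (?g *\<^sub>R w)"
    by (rule mult_left_mono) simp
  have "c - v \<bullet> w = v \<bullet> (D *v w)"
    by (simp add: c matrix_vector_mult_add_rdistrib inner_add_right)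
  then have "\<bar>c - v \<bullet> w\<bar> \<le> norm v * norm (?g *\<^sub>R w)"
    using order_trans[OF Cauchy_Schwarz_ineq2 le] by simp
  then show ?thesis
    using g by (simp add: mult_ac)
qed

text \<open>The errors \<open>d1\<close>, \<open>d2\<close>, \<open>d3\<close> of numerator,
  division and denominator merge into one factor \<open>(1 + d3) / ((1 + d1) * (1 + d2))\<close>.
  The denominator appears as \<open>s\<close>, before its own rounding: for \<beta> this is
  \<open>1 + vz\<close>, which later links \<theta>1 (1 + \<open>vz\<close>) u to \<open>B\<close>
  and \<open>p\<close>.\<close>

lemma fl_quotient_factor:
  assumes "0 \<le> eps" "eps < 1" and "fl eps s t" "fl eps a r" "fl eps (r / t) q" "t \<noteq> 0"
  obtains \<eta> where "a = (1 + \<eta>) * s * q" "\<bar>\<eta>\<bar> \<le> 3 * eps / (1 - eps)\<^sup>2"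
proof -
  obtain d1 d2 d3 where d: "\<bar>d1\<bar> \<le> eps" "\<bar>d2\<bar> \<le> eps" "\<bar>d3\<bar> \<le> eps"
    and eqs: "t = s * (1 + d3)" "r = a * (1 + d1)" "q = r / t * (1 + d2)"
    using assms unfolding fl_def by blast
  define m where "m = (1 + d1) * (1 + d2)"
  define \<eta> where "\<eta> = (1 + d3) / m - 1"
  have m: "(1 - eps)\<^sup>2 \<le> m" "0 < m"
    unfolding m_def power2_eq_square using d assms by (auto intro!: mult_mono mult_pos_pos)
  have "q * t = a * m"
    unfolding eqs(3) using \<open>t \<noteq> 0\<close> by (simp add: eqs(2) m_def mult_ac)
  moreover have "1 + d3 = (1 + \<eta>) * m"
    using m by (simp add: \<eta>_def)
  ultimately have "a = (1 + \<eta>) * s * q"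
    using m by (simp add: eqs(1) mult_ac)
  moreover have "\<bar>\<eta>\<bar> \<le> 3 * eps / (1 - eps)\<^sup>2"
  proof -
    \<comment> \<open>Both extremes of \<open>(1 + d3) / m\<close> are examined. From below even
      \<open>1 - 3 * eps\<close> holds; from above the numerators compare because (1 - eps)^2 + 3
      eps = 1 + eps + eps^2.\<close>
    have "m \<le> (1 + eps)\<^sup>2"
      unfolding m_def power2_eq_square using d assms by (intro mult_mono) auto
    then have "(1 - eps) / (1 + eps)\<^sup>2 \<le> (1 + d3) / m"
      using d m assms by (intro frac_le) auto
    moreover have "1 - 3 * eps \<le> (1 - eps) / (1 + eps)\<^sup>2"
    proof -
      have "(1 - 3 * eps) * (1 + eps)\<^sup>2 = 1 - eps - 5 * eps\<^sup>2 - 3 * eps ^ 3"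
        by (simp add: power2_eq_square power3_eq_cube algebra_simps)
      then have "(1 - 3 * eps) * (1 + eps)\<^sup>2 \<le> 1 - eps"
        using assms zero_le_power[of eps 2] zero_le_power[of eps 3] by linarith
      then show ?thesis
        using assms by (simp add: pos_le_divide_eq)
    qed
    moreover have "3 * eps \<le> 3 * eps / (1 - eps)\<^sup>2"
      using assms by (simp add: pos_le_divide_eq mult_left_le power_le_one)
    moreover have "(1 + d3) / m \<le> (1 + eps) / (1 - eps)\<^sup>2"
      using d m assms by (intro frac_le) auto
    moreover have "(1 + eps) / (1 - eps)\<^sup>2 \<le> 1 + 3 * eps / (1 - eps)\<^sup>2"
    proof -
      have "1 + 3 * eps / (1 - eps)\<^sup>2 = ((1 - eps)\<^sup>2 + 3 * eps) / (1 - eps)\<^sup>2"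
        using assms by (simp add: add_divide_distrib)
      also have "\<dots> \<ge> (1 + eps) / (1 - eps)\<^sup>2"
        by (rule divide_right_mono) (simp add: power2_eq_square algebra_simps, simp)
      finally show ?thesis .
    qed
    ultimately show ?thesis
      unfolding \<eta>_def abs_le_iff by linarith
  qed
  ultimately show thesis
    by (rule that)
qed

section \<open>Residual of the computed solution\<close>

text \<open>The factor \<open>H = 1 + O(e)\<close> absorbs all products of higher order.\<close>

lemma msm_residual_bound:
  fixes A B :: "real ^ 'n ^ 'n" and u v b :: "real ^ 'n"
  assumes e: "0 < e" and C1: "cs * e < 1" and N1: "real CARD('n) * e < 1" and cs: "0 \<le> cs"
    and B: "B = A + outer u v"
    and msm: "msm_computed cs e A u v b y z \<alpha> \<beta> \<theta> d w \<theta>1 p x"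
    and \<beta>: "\<beta> \<noteq> 0"
    and S: "S = mnorm2 A + norm u * norm v"
    and H: "H = (1 + cs * e) / ((1 - e) ^ 3 * (1 - cs * e) * (1 - real CARD('n) * e))"
  shows "norm (B *v x - b) \<le> e * H * ((1 + cs) * norm b + (real CARD('n) + cs + 3) * S * norm x
    + (2 * real CARD('n) + 2 * cs + 4) * S * norm p + cs * norm u * (\<bar>\<theta>\<bar> + \<bar>\<theta>1\<bar>))"
proof -
  define n where "n = real CARD('n)"
  define C where "C = cs * e"
  define N where "N = n * e"
  define q where "q = 1 / (1 - e)"
  define g where "g = fp_gamma e CARD('n)"
  define a where "a = mnorm2 A"
  \<comment> \<open>\<open>Z\<close> is the vector whose entrywise rounding is
    \<open>p\<close>.\<close>
  define Z where "Z = \<theta>1 *\<^sub>R z"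
  have n: "1 \<le> n"
    by (simp add: n_def Suc_le_eq)
  have "e * 1 \<le> e * n"
    using n e by (intro mult_left_mono) auto
  then have e1: "e < 1"
    using N1 by (simp add: n_def mult_ac)
  have CN: "0 \<le> C" "C < 1" "0 \<le> N" "N < 1"
    using cs e C1 N1 n by (auto simp: C_def N_def n_def)
  have gN: "g = N / (1 - N)"
    by (simp add: g_def N_def n_def fp_gamma_def)
  have g: "0 \<le> g"
    using CN by (simp add: gN)
  have a: "0 \<le> a"
    by (simp add: a_def mnorm2_nonneg)

  obtain \<delta>A \<delta>u where z: "(A + \<delta>A) *v z = u + \<delta>u" "mnorm2 \<delta>A \<le> C * a" "norm \<delta>u \<le> C * norm u"
    using msm by (auto simp: msm_computed_def backward_stable_solution_def C_def a_def)
  obtain \<delta>A' \<delta>d where w: "(A + \<delta>A') *v w = d + \<delta>d" "mnorm2 \<delta>A' \<le> C * a" "norm \<delta>d \<le> C * norm d"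
    using msm by (auto simp: msm_computed_def backward_stable_solution_def C_def a_def)
  obtain vz vw r ut where fl: "fl_inner e v z vz" "fl e (1 + vz) \<beta>"
    "fl_vec e (\<theta> *\<^sub>R u) ut" "fl_vec e (b - ut) d"
    "fl_inner e v w vw" "fl e (vw - \<theta>) r" "fl e (r / \<beta>) \<theta>1"
    "fl_vec e Z p" "fl_vec e (w - p) x"
    using msm by (auto simp: msm_computed_def Z_def)
  obtain \<eta> where \<eta>: "vw - \<theta> = (1 + \<eta>) * (1 + vz) * \<theta>1" "\<bar>\<eta>\<bar> \<le> 3 * e / (1 - e)\<^sup>2"
    using fl_quotient_factor[OF _ e1 fl(2,6,7) \<beta>] e by auto
  define e1 where "e1 = x - (w - p)"
  define e2 where "e2 = p - Z"
  define e3 where "e3 = ut - \<theta> *\<^sub>R u"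
  define e4 where "e4 = d - (b - ut)"
  define \<eta>1 where "\<eta>1 = vw - v \<bullet> w"
  define \<eta>2 where "\<eta>2 = vz - v \<bullet> z"

  \<comment> \<open>Exact expansion of the residual into error terms\<close>
  have Bv: "B *v t = A *v t + (v \<bullet> t) *\<^sub>R u" for t
    by (simp add: B matrix_vector_mult_add_rdistrib outer_vector_mult)
  have Az: "A *v z = u + \<delta>u - \<delta>A *v z"
    using z(1) by (simp add: matrix_vector_mult_add_rdistrib algebra_simps)
  have Aw: "A *v w = d + \<delta>d - \<delta>A' *v w"
    using w(1) by (simp add: matrix_vector_mult_add_rdistrib algebra_simps)
  have AZ: "A *v Z = \<theta>1 *\<^sub>R u + \<theta>1 *\<^sub>R \<delta>u - \<delta>A *v Z"
    unfolding Z_def matrix_vector_mult_scaleR Az by (simp add: algebra_simps)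
  have vZ: "v \<bullet> Z = \<theta>1 * (v \<bullet> z)"
    by (simp add: Z_def)
  \<comment> \<open>Since A Z is nearly \<theta>1 u, \<open>M\<close> agrees with B Z up to error
    terms. A bound on \<open>M\<close> then involves the norm of \<open>p\<close> and not the size
    of \<open>1 + vz\<close>.\<close>
  define M where "M = ((1 + vz) * \<theta>1) *\<^sub>R u"
  have M: "M = B *v Z + \<delta>A *v Z - \<theta>1 *\<^sub>R \<delta>u + (\<theta>1 * \<eta>2) *\<^sub>R u"
    unfolding M_def Bv AZ \<eta>2_def by (simp add: vZ algebra_simps)
  have vw: "v \<bullet> w = \<theta> + (1 + \<eta>) * (1 + vz) * \<theta>1 - \<eta>1"
    using \<eta>(1) by (simp add: \<eta>1_def)
  \<comment> \<open>This inserts the split \<open>x = e1 + w - Z - e2\<close>.\<close>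
  have "B *v x - b = B *v e1 + (A *v w + (v \<bullet> w) *\<^sub>R u) - (A *v Z + (v \<bullet> Z) *\<^sub>R u) - B *v e2 - b"
    unfolding Bv[symmetric] by (simp add: e1_def e2_def algebra_simps)
  also have "\<dots> = B *v e1 - e3 + e4 + \<delta>d - \<delta>A' *v w + \<delta>A *v Z - \<theta>1 *\<^sub>R \<delta>u - B *v e2
    + (\<theta>1 * \<eta>2) *\<^sub>R u - \<eta>1 *\<^sub>R u + \<eta> *\<^sub>R M"
  proof -
    \<comment> \<open>Two cancellations remove everything of order zero: \<open>M\<close> against B
      Z, and d + \<theta> u against \<open>b\<close>.\<close>
    have "(v \<bullet> w) *\<^sub>R u = \<theta> *\<^sub>R u + M + \<eta> *\<^sub>R M - \<eta>1 *\<^sub>R u"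
      unfolding vw M_def by (simp add: algebra_simps)
    moreover have "M - A *v Z - (v \<bullet> Z) *\<^sub>R u = \<delta>A *v Z - \<theta>1 *\<^sub>R \<delta>u + (\<theta>1 * \<eta>2) *\<^sub>R u"
      unfolding M Bv by simp
    moreover have "d + \<theta> *\<^sub>R u - b = e4 - e3"
      by (simp add: e3_def e4_def)
    ultimately show ?thesis
      unfolding Aw by (simp add: diff_eq_eq eq_diff_eq) (simp add: algebra_simps)
  qed
  finally have res: "B *v x - b = \<dots>" .

  note norm_tri = order_trans[OF norm_triangle_ineq] order_trans[OF norm_triangle_ineq4] add_mono
    order_refl
  have tri: "norm (B *v x - b) \<le> norm (B *v e1) + norm e3 + norm e4 + norm \<delta>d + norm (\<delta>A' *v w)
    + norm (\<delta>A *v Z) + norm (\<theta>1 *\<^sub>R \<delta>u) + norm (B *v e2) + norm ((\<theta>1 * \<eta>2) *\<^sub>R u)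
    + norm (\<eta>1 *\<^sub>R u) + norm (\<eta> *\<^sub>R M)"
    unfolding res by (intro norm_tri)

  \<comment> \<open>Auxiliary norm bounds through computed quantities and \<open>b\<close>\<close>
  define X where "X = norm x"
  define P where "P = norm p"
  define U where "U = norm u"
  define V where "V = norm v"
  define b' where "b' = norm b"
  have nn: "0 \<le> X" "0 \<le> P" "0 \<le> U" "0 \<le> V" "0 \<le> b'"
    by (auto simp: X_def P_def U_def V_def b'_def)
  have S': "S = a + U * V" "0 \<le> S"
    using nn a by (auto simp: S a_def U_def V_def)
  have e': "0 \<le> e"
    using e by simp
  have q: "1 \<le> q"
    using \<open>e < 1\<close> e by (simp add: q_def)

  have B_le: "norm (B *v t) \<le> S * norm t" for t
    using norm_matrix_vector_le_mnorm2[of B t] mnorm2_add_outer_le[of A u v]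
    unfolding B S by (meson mult_right_mono norm_ge_zero order_trans)
  have normQ: "norm (w - p) \<le> q * X"
    using fl_vec_norm_le[OF fl(9) e' \<open>e < 1\<close>] by (simp add: q_def X_def)
  have normZ: "norm Z \<le> q * P"
    using fl_vec_norm_le[OF fl(8) e' \<open>e < 1\<close>] by (simp add: q_def P_def)
  have normW: "norm w \<le> q * X + P"
    using normQ norm_triangle_ineq[of "w - p" p] by (simp add: P_def)
  have normW': "norm w \<le> q * (X + P)"
    using normW mult_right_mono[OF q \<open>0 \<le> P\<close>] by (simp add: algebra_simps)
  have \<delta>Aw: "norm (\<delta>A' *v w) \<le> C * a * norm w"
    using norm_matrix_vector_le_mnorm2[of \<delta>A' w] w(2) by (meson mult_right_mono norm_ge_zero order_trans)
  have \<delta>AZ: "norm (\<delta>A *v Z) \<le> C * a * norm Z"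
    using norm_matrix_vector_le_mnorm2[of \<delta>A Z] z(2) by (meson mult_right_mono norm_ge_zero order_trans)
  \<comment> \<open>The two bounds on \<open>d\<close> have different uses. This one goes through
    \<open>w\<close>, contains no \<theta> and serves the rounding errors \<open>e3\<close> and
    \<open>e4\<close>. The bound \<open>normd'\<close> admits the modulus of \<theta> and serves
    \<open>\<delta>d\<close>, which carries the factor \<open>cs\<close>.\<close>
  have normd: "norm d \<le> (1 + C) / (1 - C) * (a * norm w)"
  proof -
    have "d = A *v w + \<delta>A' *v w - \<delta>d"
      using Aw by simp
    then have "norm d \<le> norm (A *v w) + norm (\<delta>A' *v w) + norm \<delta>d"
      by (simp only:) (intro norm_tri)
    also have "\<dots> \<le> a * norm w + C * a * norm w + C * norm d"
      using norm_matrix_vector_le_mnorm2[of A w] \<delta>Aw w(3) unfolding a_def by linarith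
    finally show ?thesis
      using CN by (simp add: field_simps)
  qed
  have normd': "norm d \<le> q\<^sup>2 * (b' + U * \<bar>\<theta>\<bar>)"
  proof -
    have ut: "norm ut \<le> (1 + e) * (U * \<bar>\<theta>\<bar>)"
      using fl_vec_error[OF fl(3) e'] norm_triangle_ineq2[of ut "\<theta> *\<^sub>R u"]
      by (simp add: U_def algebra_simps)
    have "norm d \<le> (1 + e) * norm (b - ut)"
      using fl_vec_error[OF fl(4) e'] norm_triangle_ineq2[of d "b - ut"]
      by (simp add: algebra_simps)
    also have "\<dots> \<le> (1 + e) * (b' + (1 + e) * (U * \<bar>\<theta>\<bar>))"
      using ut norm_triangle_ineq4[of b ut] e' by (intro mult_left_mono) (auto simp: b'_def)
    also have "\<dots> \<le> (1 + e) * ((1 + e) * b' + (1 + e) * (U * \<bar>\<theta>\<bar>))"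
      using e' nn mult_right_mono[of 1 "1 + e" b'] by (intro mult_left_mono) auto
    also have "\<dots> = (1 + e)\<^sup>2 * (b' + U * \<bar>\<theta>\<bar>)"
      by (simp add: power2_eq_square algebra_simps)
    also have "\<dots> \<le> q\<^sup>2 * (b' + U * \<bar>\<theta>\<bar>)"
    proof (intro mult_right_mono power_mono)
      show "1 + e \<le> q"
        using e \<open>e < 1\<close> by (simp add: q_def field_simps)
    qed (use e' nn in auto)
    finally show ?thesis .
  qed

  \<comment> \<open>\<open>R\<close> is the factor from \<open>normd\<close>, and \<open>L\<close>
    is the denominator of \<open>fp_gamma\<close>, so that \<open>g = N * L\<close>.\<close>
  define R where "R = (1 + C) / (1 - C)"
  define L where "L = 1 / (1 - N)"
  have RL: "1 \<le> R" "1 \<le> L" "1 + C \<le> R" "g = N * L" "1 + g = L"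
    using CN by (auto simp: R_def L_def gN field_simps)
  have H': "H = q ^ 3 * R * L"
    by (simp add: H q_def R_def L_def C_def N_def n_def power_divide)
  \<comment> \<open>A budget: every error term uses at most three factors \<open>q\<close>, one
    \<open>R\<close> and one \<open>L\<close>, which explains the shape of \<open>H\<close>. The
    list \<open>le_H\<close> specializes to terms without \<open>R\<close> or without
    \<open>L\<close>.\<close>
  have "q ^ i * r * l \<le> H" if "i \<le> 3" "0 \<le> r" "0 \<le> l" "r \<le> R" "l \<le> L" for i r l
    unfolding H' using that q RL by (intro mult_mono power_increasing) auto
  note le_H = this[where r = 1 and l = 1] this[where l = 1] this[where r = 1] this
  have H0: "0 \<le> H"
    using q RL by (simp add: H')

  \<comment> \<open>Bounds on the individual error terms\<close>
  have t1: "norm (B *v e1) \<le> e * H * (S * X)"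
  proof -
    have "norm (B *v e1) \<le> S * (e * (q * X))"
      using B_le[of e1] fl_vec_error[OF fl(9) e'] mult_left_mono[OF normQ e'] S'
      unfolding e1_def by (meson mult_left_mono order_trans)
    also have "\<dots> = e * q * (S * X)"
      by simp
    also have "\<dots> \<le> e * H * (S * X)"
      using le_H(1)[of 1] RL e' S' nn by (intro mult_right_mono mult_left_mono) auto
    finally show ?thesis .
  qed
  have dW: "q\<^sup>2 * norm d \<le> H * (a * (X + P))"
  proof -
    have "q\<^sup>2 * norm d \<le> q\<^sup>2 * (R * (a * (q * (X + P))))"
      using normd mult_left_mono[OF mult_left_mono[OF normW' a], of R] RL
      by (intro mult_left_mono) (auto simp: R_def)
    also have "\<dots> = q ^ 3 * R * (a * (X + P))"
      by (simp add: power2_eq_square power3_eq_cube)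
    also have "\<dots> \<le> H * (a * (X + P))"
      using le_H(2)[of 3 R] RL a nn by (intro mult_right_mono) auto
    finally show ?thesis .
  qed
  have bu: "norm (b - ut) \<le> q * norm d"
    using fl_vec_norm_le[OF fl(4) e' \<open>e < 1\<close>] by (simp add: q_def)
  have t4: "norm e4 \<le> e * H * (a * (X + P))"
  proof -
    have "norm e4 \<le> e * (q * norm d)"
      using fl_vec_error[OF fl(4) e'] mult_left_mono[OF bu e'] unfolding e4_def by linarith
    also have "\<dots> \<le> e * (q\<^sup>2 * norm d)"
      using q e' by (intro mult_left_mono mult_right_mono) (auto simp: power2_eq_square)
    also have "\<dots> \<le> e * (H * (a * (X + P)))"
      using dW e' by (intro mult_left_mono) auto
    finally show ?thesis by (simp add: mult_ac)
  qed
  have t3: "norm e3 \<le> e * H * (b' + a * (X + P))"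
  proof -
    \<comment> \<open>\<theta> u is recovered from its rounded value
      \<open>ut = b - (b - ut)\<close>, and \<open>b - ut\<close> from \<open>d\<close>, so the
      bound involves \<open>b\<close>, \<open>x\<close> and \<open>p\<close> but not
      \<theta>.\<close>
    have "norm (\<theta> *\<^sub>R u) \<le> q * norm ut"
      using fl_vec_norm_le[OF fl(3) e' \<open>e < 1\<close>] by (simp add: q_def)
    also have "\<dots> \<le> q * (b' + q * norm d)"
      using bu norm_triangle_sub[of ut b] q
      by (intro mult_left_mono) (auto simp: b'_def norm_minus_commute)
    also have "\<dots> = q * b' + q\<^sup>2 * norm d"
      by (simp add: power2_eq_square algebra_simps)
    also have "\<dots> \<le> H * b' + H * (a * (X + P))"
      using le_H(1)[of 1] RL nn dW by (intro add_mono mult_right_mono) auto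
    finally have "norm (\<theta> *\<^sub>R u) \<le> H * (b' + a * (X + P))"
      by (simp add: algebra_simps)
    from mult_left_mono[OF this e'] show ?thesis
      using fl_vec_error[OF fl(3) e'] unfolding e3_def mult.assoc by linarith
  qed
  have t5: "norm \<delta>d \<le> C * H * (b' + U * \<bar>\<theta>\<bar>)"
  proof -
    have "q\<^sup>2 * (b' + U * \<bar>\<theta>\<bar>) \<le> H * (b' + U * \<bar>\<theta>\<bar>)"
      using le_H(1)[of 2] RL nn by (intro mult_right_mono) auto
    with normd' have "norm d \<le> H * (b' + U * \<bar>\<theta>\<bar>)"
      by linarith
    from mult_left_mono[OF this CN(1)] show ?thesis
      using w(3) unfolding mult.assoc by linarith
  qed
  have qX: "q * t \<le> H * t" "q * L * t \<le> H * t" if "0 \<le> t" for t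
    using le_H(1)[of 1] le_H(3)[of 1 L] RL that by (auto intro!: mult_right_mono)
  have t6: "norm (\<delta>A' *v w) \<le> C * H * (a * (X + P))"
  proof -
    have "a * norm w \<le> q * (a * (X + P))"
      using mult_left_mono[OF normW' a] by (simp add: mult_ac)
    also have "\<dots> \<le> H * (a * (X + P))"
      using a nn by (intro qX) auto
    finally have "a * norm w \<le> \<dots>" .
    from mult_left_mono[OF this CN(1)] show ?thesis
      using \<delta>Aw unfolding mult.assoc by linarith
  qed
  have t7: "norm (\<delta>A *v Z) \<le> C * H * (a * P)"
  proof -
    have "a * norm Z \<le> q * (a * P)"
      using mult_left_mono[OF normZ a] by (simp add: mult_ac)
    also have "\<dots> \<le> H * (a * P)"
      using a nn by (intro qX) auto
    finally have "a * norm Z \<le> \<dots>" .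
    from mult_left_mono[OF this CN(1)] show ?thesis
      using \<delta>AZ unfolding mult.assoc by linarith
  qed
  have t8: "norm (B *v e2) \<le> e * H * (S * P)"
  proof -
    have "norm (B *v e2) \<le> S * (e * (q * P))"
      using B_le[of e2] fl_vec_error[OF fl(8) e'] mult_left_mono[OF normZ e'] S'
      unfolding e2_def by (meson mult_left_mono order_trans)
    also have "\<dots> = e * (q * (S * P))"
      by simp
    also have "\<dots> \<le> e * (H * (S * P))"
      using e' S' nn by (intro mult_left_mono qX) auto
    finally show ?thesis by simp
  qed
  have t9: "norm ((\<theta>1 * \<eta>2) *\<^sub>R u) \<le> g * (U * V) * norm Z"
  proof -
    have "\<bar>\<eta>2\<bar> \<le> g * (V * norm z)"
      using fl_inner_error[OF fl(1) e' N1] by (simp add: \<eta>2_def g_def V_def)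
    from mult_left_mono[OF this, of "\<bar>\<theta>1\<bar> * U"] show ?thesis
      using nn by (simp add: abs_mult Z_def U_def mult_ac)
  qed
  have gH: "g * (q * t) \<le> N * H * t" if "0 \<le> t" for t
    using mult_left_mono[OF qX(2)[OF that] CN(3)] by (simp add: RL(4) mult_ac)
  have t9': "norm ((\<theta>1 * \<eta>2) *\<^sub>R u) \<le> N * H * (U * V * P)"
  proof -
    have "g * (U * V) * norm Z \<le> g * (U * V) * (q * P)"
      using normZ g nn by (intro mult_left_mono) auto
    then show ?thesis
      using t9 gH[of "U * V * P"] nn by (simp add: mult_ac)
  qed
  have t10: "norm (\<eta>1 *\<^sub>R u) \<le> N * H * (U * V * (X + P))"
  proof -
    have "\<bar>\<eta>1\<bar> \<le> g * (V * norm w)"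
      using fl_inner_error[OF fl(5) e' N1] by (simp add: \<eta>1_def g_def V_def)
    from mult_right_mono[OF this \<open>0 \<le> U\<close>]
    have "norm (\<eta>1 *\<^sub>R u) \<le> g * (U * V) * norm w"
      by (simp add: U_def mult_ac)
    also have "\<dots> \<le> g * (U * V) * (q * (X + P))"
      using normW' g nn by (intro mult_left_mono) auto
    finally show ?thesis
      using gH[of "U * V * (X + P)"] nn by (simp add: mult_ac)
  qed
  have t\<delta>u: "norm (\<theta>1 *\<^sub>R \<delta>u) \<le> C * (U * \<bar>\<theta>1\<bar>)"
    using mult_left_mono[OF z(3), of "\<bar>\<theta>1\<bar>"] by (simp add: U_def mult_ac)
  have \<eta>q: "\<bar>\<eta>\<bar> \<le> 3 * e * q\<^sup>2"
    using \<eta>(2) by (simp add: q_def power_divide)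
  have normM: "norm M \<le> R * L * S * norm Z + C * (U * \<bar>\<theta>1\<bar>)"
  proof -
    have "norm M \<le> norm (B *v Z) + norm (\<delta>A *v Z) + norm (\<theta>1 *\<^sub>R \<delta>u) + norm ((\<theta>1 * \<eta>2) *\<^sub>R u)"
      unfolding M by (intro norm_tri)
    also have "\<dots> \<le> S * norm Z + C * a * norm Z + C * (U * \<bar>\<theta>1\<bar>) + g * (U * V) * norm Z"
      using B_le[of Z] \<delta>AZ t\<delta>u t9 by linarith
    also have "\<dots> = ((1 + C) * a + (1 + g) * (U * V)) * norm Z + C * (U * \<bar>\<theta>1\<bar>)"
      by (simp add: S' algebra_simps)
    also have "\<dots> \<le> (R * L * a + R * L * (U * V)) * norm Z + C * (U * \<bar>\<theta>1\<bar>)"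
    proof -
      have "(1 + C) * 1 \<le> R * L" "1 * (1 + g) \<le> R * L"
        using RL CN g by (intro mult_mono; simp)+
      then show ?thesis
        using a nn by (intro add_right_mono mult_right_mono add_mono) auto
    qed
    finally show ?thesis
      by (simp add: S' algebra_simps)
  qed
  \<comment> \<open>The two terms are bounded jointly because \<open>M\<close> itself contributes a
    multiple of the modulus of \<theta>1. The combined factor \<open>1 + 3 * e * q^2\<close> stays
    below \<open>q ^ 3\<close>, since (1 - e)^3 + 3 e (1 - e) = 1 - e^3, so the coefficient remains
    \<open>cs\<close> up to \<open>H\<close>.\<close>
  have t11: "norm (\<theta>1 *\<^sub>R \<delta>u) + norm (\<eta> *\<^sub>R M) \<le> 3 * e * H * (S * P) + C * H * (U * \<bar>\<theta>1\<bar>)"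
  proof -
    have "R * L * S * norm Z \<le> R * L * S * (q * P)"
      using normZ RL S' by (intro mult_left_mono) auto
    then have "norm (\<eta> *\<^sub>R M) \<le> 3 * e * q\<^sup>2 * (R * L * S * (q * P) + C * (U * \<bar>\<theta>1\<bar>))"
      using normM \<eta>q e' by (auto intro!: mult_mono)
    also have "\<dots> = 3 * e * H * (S * P) + 3 * e * q\<^sup>2 * (C * (U * \<bar>\<theta>1\<bar>))"
      by (simp add: H' power2_eq_square power3_eq_cube algebra_simps)
    finally have "norm (\<theta>1 *\<^sub>R \<delta>u) + norm (\<eta> *\<^sub>R M)
        \<le> 3 * e * H * (S * P) + (1 + 3 * e * q\<^sup>2) * (C * (U * \<bar>\<theta>1\<bar>))"
      using t\<delta>u by (simp add: algebra_simps)
    moreover have "1 + 3 * e * q\<^sup>2 \<le> H"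
    proof -
      have "1 + 3 * e * q\<^sup>2 \<le> q ^ 3"
      proof -
        have D: "0 < (1 - e) ^ 3"
          using \<open>e < 1\<close> by simp
        have "3 * e * q\<^sup>2 = 3 * e * (1 - e) / (1 - e) ^ 3"
          using \<open>e < 1\<close> by (simp add: q_def power2_eq_square power3_eq_cube)
        then have "1 + 3 * e * q\<^sup>2 = ((1 - e) ^ 3 + 3 * e * (1 - e)) / (1 - e) ^ 3"
          using \<open>e < 1\<close> by (simp add: add_divide_distrib)
        also have "\<dots> \<le> 1 / (1 - e) ^ 3"
          using D e' by (intro divide_right_mono) (simp_all add: power3_eq_cube algebra_simps)
        finally show ?thesis
          by (simp add: q_def power_divide)
      qed
      also have "q ^ 3 \<le> H"
        using le_H(1)[of 3] RL by simp
      finally show ?thesis .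
    qed
    then have "(1 + 3 * e * q\<^sup>2) * (C * (U * \<bar>\<theta>1\<bar>)) \<le> H * (C * (U * \<bar>\<theta>1\<bar>))"
      using CN nn by (intro mult_right_mono) auto
    ultimately show ?thesis
      by (simp add: mult_ac)
  qed

  \<comment> \<open>Collecting the coefficients\<close>
  have "norm (B *v x - b) \<le> e * H * (S * X) + e * H * (b' + a * (X + P)) + e * H * (a * (X + P))
    + C * H * (b' + U * \<bar>\<theta>\<bar>) + C * H * (a * (X + P)) + C * H * (a * P) + e * H * (S * P)
    + N * H * (U * V * P) + N * H * (U * V * (X + P)) + 3 * e * H * (S * P)
    + C * H * (U * \<bar>\<theta>1\<bar>)"
    using tri t1 t3 t4 t5 t6 t7 t8 t9' t10 t11 by linarith
  also have "\<dots> = e * H * ((1 + cs) * b' + (S + (2 + cs) * a + n * (U * V)) * X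
    + ((2 + 2 * cs) * a + 2 * n * (U * V) + 4 * S) * P + cs * U * (\<bar>\<theta>\<bar> + \<bar>\<theta>1\<bar>))"
    by (simp add: C_def N_def algebra_simps)
  also have "\<dots> \<le> e * H * ((1 + cs) * b' + (n + cs + 3) * S * X + (2 * n + 2 * cs + 4) * S * P
    + cs * U * (\<bar>\<theta>\<bar> + \<bar>\<theta>1\<bar>))"
  proof -
    \<comment> \<open>Coefficients of \<open>a\<close> and of \<open>U * V\<close> are compared
      separately. For \<open>p\<close> the coefficient of \<open>a\<close> is
      \<open>6 + 2 * cs\<close>, which is at most \<open>2 * n + 2 * cs + 4\<close> because
      \<open>n\<close> is at least 1.\<close>
    have "0 \<le> n * a" "1 * a \<le> n * a" "0 \<le> cs * (U * V)" "0 \<le> U * V"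
      using n a cs nn mult_right_mono[OF n a] by auto
    then have "S + (2 + cs) * a + n * (U * V) \<le> (n + cs + 3) * S"
      "(2 + 2 * cs) * a + 2 * n * (U * V) + 4 * S \<le> (2 * n + 2 * cs + 4) * S"
      by (simp_all add: S' algebra_simps)
    then show ?thesis
      using e' H0 nn by (intro mult_left_mono add_mono mult_right_mono) auto
  qed
  finally show ?thesis
    by (simp add: n_def X_def P_def U_def b'_def)
qed

text \<open>The factor \<open>1 + C\<close> is paid for by doubling \<open>C\<close>, as (1 - 2 C)(1
  + C) \<le> 1 - C; Bernoulli treats the cube, and a product of factors 1 - a is at least 1 minus
  the sum of the a. In the application N + C + 3 e is at most \<open>t\<close>.\<close>

lemma msm_second_order_factor_le:
  fixes e C N :: real
  assumes "0 \<le> e" "0 \<le> C" "0 \<le> N" and small: "2 * (N + C + 3 * e) < 1"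
  shows "(1 + C) / ((1 - e) ^ 3 * (1 - C) * (1 - N)) \<le> 1 / (1 - 2 * (N + C + 3 * e))"
proof -
  have e3: "1 - 3 * e \<le> (1 - e) ^ 3"
    using Bernoulli_inequality[of "- e" 3] assms by simp
  have prod: "1 - a - b \<le> (1 - a) * (1 - b)" if "0 \<le> a" "0 \<le> b" for a b :: real
    using that by (simp add: algebra_simps)
  have "1 - 2 * (N + C + 3 * e) \<le> 1 - (2 * C + 3 * e) - N"
    using assms by simp
  also have "\<dots> \<le> (1 - (2 * C + 3 * e)) * (1 - N)"
    using assms by (intro prod) auto
  also have "\<dots> \<le> (1 - 3 * e) * (1 - 2 * C) * (1 - N)"
    using prod[of "3 * e" "2 * C"] assms by (intro mult_right_mono) auto
  finally have "(1 - 2 * (N + C + 3 * e)) * (1 + C) \<le> (1 - 3 * e) * (1 - 2 * C) * (1 - N) * (1 + C)"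
    using assms by (intro mult_right_mono) auto
  also have "\<dots> = (1 - 3 * e) * ((1 - 2 * C) * (1 + C)) * (1 - N)"
    by (simp add: mult_ac)
  also have "\<dots> \<le> (1 - e) ^ 3 * (1 - C) * (1 - N)"
  proof (intro mult_right_mono mult_mono e3)
    show "(1 - 2 * C) * (1 + C) \<le> 1 - C"
      using assms by (simp add: algebra_simps)
  qed (use assms in auto)
  finally have "(1 + C) * (1 - 2 * (N + C + 3 * e)) \<le> 1 * ((1 - e) ^ 3 * (1 - C) * (1 - N))"
    by (simp add: mult.commute)
  moreover have "0 < (1 - e) ^ 3 * (1 - C) * (1 - N)"
    using assms by (intro mult_pos_pos zero_less_power) auto
  moreover have "x / y \<le> 1 / z" if "x * z \<le> 1 * y" "0 < y" "0 < z" for x y z :: real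
    using that by (simp add: field_simps)
  ultimately show ?thesis
    using small by simp
qed

section \<open>From the residual bound to the forward error\<close>

theorem theorem4p3:
  fixes A B :: "real ^ 'n ^ 'n"
    and u v b x :: "real ^ 'n"
    and eps cs c3t c4t c5t c3 c4 c5 :: real
    and yh zh dh wh ph xh :: "real ^ 'n"
    and \<alpha>h \<beta>h \<theta>h \<theta>1h :: real
  assumes eps_pos: "0 < eps"
    and n_eps: "real CARD('n) * eps < 1"
    and A_nonsing: "invertible A"
    and B_eq: "B = A + outer u v"
    and B_nonsing: "invertible B"
    and x_exact: "B *v x = b"
    and msm: "msm_computed cs eps A u v b yh zh \<alpha>h \<beta>h \<theta>h dh wh \<theta>1h ph xh"
    and beta_nz: "\<beta>h \<noteq> 0"
    and c3t_eq: "c3t = (real CARD('n) + cs + 3) * ((mnorm2 A + norm u * norm v) / mnorm2 B)"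
    and c4t_eq: "c4t = (2 * real CARD('n) + 2 * cs + 4) * ((mnorm2 A + norm u * norm v) / mnorm2 B)"
    and c5t_eq: "c5t = cs * norm u / mnorm2 B"
    and c3_eq: "c3 = (1 + cs + c3t) / (1 - eps * c3t * kappa2 B)"
    and c4_eq: "c4 = c4t / (1 - eps * c3t * kappa2 B)"
    and c5_eq: "c5 = c5t / (1 - eps * c3t * kappa2 B)"
    and c3t_small: "eps * c3t * kappa2 B < 1"
    and c3_small: "c3 * eps * kappa2 B < 1"
  shows "norm (xh - x) \<le> eps * kappa2 B / (1 - c3 * eps * kappa2 B) *
           (c3 * norm xh + c4 * norm ph + c5 * (\<bar>\<theta>h\<bar> + \<bar>\<theta>1h\<bar>))"
proof -
  define n where "n = real CARD('n)"
  define S where "S = mnorm2 A + norm u * norm v"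
  define E where "E = eps * kappa2 B"
  define \<Delta> where "\<Delta> = norm (xh - x)"
  define T where "T = \<bar>\<theta>h\<bar> + \<bar>\<theta>1h\<bar>"
  define H where "H = (1 + cs * eps) / ((1 - eps) ^ 3 * (1 - cs * eps) * (1 - n * eps))"
  have \<kappa>: "1 \<le> kappa2 B"
    using B_nonsing by (rule kappa2_ge_1)
  have mA: "0 < mnorm2 A"
    using kappa2_ge_1[OF A_nonsing] mnorm2_nonneg[of A] by (auto simp: kappa2_def less_le)
  have mB: "0 < mnorm2 B"
    using \<kappa> mnorm2_nonneg[of B] by (auto simp: kappa2_def less_le)
  \<comment> \<open>The sign of \<open>cs\<close> is read off from the existence of a backward
    error: its norm is nonnegative, and \<open>A\<close> has positive norm.\<close>
  have "0 \<le> cs * eps * mnorm2 A"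
    using msm unfolding msm_computed_def backward_stable_solution_def
    by (meson mnorm2_nonneg order_trans)
  then have cs: "0 \<le> cs"
    using mA eps_pos by (simp add: zero_le_mult_iff)
  have n0: "0 \<le> n"
    by (simp add: n_def)
  have SB: "1 \<le> S / mnorm2 B"
    using mnorm2_add_outer_le[of A u v] mB by (simp add: S_def B_eq pos_le_divide_eq)
  have c3t: "c3t = (n + cs + 3) * (S / mnorm2 B)" and c4t: "c4t = (2 * n + 2 * cs + 4) * (S / mnorm2 B)"
    by (simp_all add: c3t_eq c4t_eq S_def n_def)
  have E: "eps \<le> E" "0 \<le> E"
    using mult_left_mono[OF \<kappa>, of eps] eps_pos by (auto simp: E_def)
  have c3t_ge: "n + cs + 3 \<le> c3t"
    using mult_left_mono[OF SB, of "n + cs + 3"] cs n0 by (simp add: c3t)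
  define t where "t = E * c3t"
  \<comment> \<open>One inequality controls \<open>n * eps\<close>, \<open>cs * eps\<close> and
    \<open>3 * eps\<close> together by \<open>t\<close>.\<close>
  have t_ge: "eps * (n + cs + 3) \<le> t"
    unfolding t_def using E c3t_ge cs n0 by (intro mult_mono) auto
  have t1: "0 < 1 - t"
    using c3t_small by (simp add: t_def E_def mult_ac)
  have c3E: "c3 * E = (1 + cs + c3t) * E / (1 - t)"
    by (simp add: c3_eq t_def E_def mult_ac)
  \<comment> \<open>\<open>K\<close> equals \<open>(1 - t) * (1 - c3 * E)\<close>. Its positivity,
    which comes from \<open>c3_small\<close>, forces \<open>2 * t < 1\<close> and hence also
    \<open>cs * eps < 1\<close>.\<close>
  define K where "K = 1 - 2 * t - E * (1 + cs)"
  have "c3 * E < 1"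
    using c3_small by (simp add: E_def mult_ac)
  then have K: "0 < K"
    using t1 unfolding c3E K_def by (simp add: pos_divide_less_eq t_def algebra_simps)
  have "0 \<le> E * (1 + cs)"
    using E cs by simp
  then have t2: "2 * t < 1"
    using K by (simp add: K_def)
  have ncs: "0 \<le> n * eps" "0 \<le> cs * eps" "eps * (n + cs + 3) = n * eps + cs * eps + 3 * eps"
    using n0 cs eps_pos by (auto simp: algebra_simps)
  have cs1: "cs * eps < 1"
    using ncs t_ge t2 eps_pos by linarith
  have "H \<le> 1 / (1 - 2 * (n * eps + cs * eps + 3 * eps))"
    unfolding H_def using ncs eps_pos t_ge t2 by (intro msm_second_order_factor_le) auto
  also have "\<dots> \<le> 1 / (1 - 2 * t)"
    using t_ge t2 by (intro divide_left_mono) (auto simp: ncs(3))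
  finally have H: "H \<le> 1 / (1 - 2 * t)" .

  let ?R = "(1 + cs) * norm b + (n + cs + 3) * S * norm xh + (2 * n + 2 * cs + 4) * S * norm ph
    + cs * norm u * T"
  let ?F = "(1 + cs + c3t) * norm xh + c4t * norm ph + c5t * T"
  have F0: "0 \<le> ?F"
    using cs n0 SB mB by (auto intro!: add_nonneg_nonneg mult_nonneg_nonneg simp: c3t c4t c5t_eq T_def)
  have res: "norm (B *v xh - b) \<le> eps * H * ?R"
    unfolding n_def T_def
    by (rule msm_residual_bound[OF eps_pos cs1 n_eps cs B_eq msm beta_nz S_def H_def[unfolded n_def]])
  \<comment> \<open>Replacing \<open>b\<close> by B x brings the error \<Delta> to the right-hand
    side as well. Its coefficient there, \<open>E * (1 + cs)\<close>, is moved to the left at the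
    end and becomes the last term of \<open>K\<close>.\<close>
  have "norm b \<le> mnorm2 B * (norm xh + \<Delta>)"
  proof -
    have "norm b \<le> mnorm2 B * norm x"
      using norm_matrix_vector_le_mnorm2[of B x] x_exact by simp
    also have "\<dots> \<le> mnorm2 B * (norm xh + \<Delta>)"
      using mB norm_triangle_sub[of x xh] by (intro mult_left_mono) (auto simp: \<Delta>_def norm_minus_commute)
    finally show ?thesis .
  qed
  then have "?R \<le> (1 + cs) * (mnorm2 B * (norm xh + \<Delta>)) + (n + cs + 3) * S * norm xh
      + (2 * n + 2 * cs + 4) * S * norm ph + cs * norm u * T"
    using cs by (intro add_right_mono mult_left_mono) auto
  also have "\<dots> = mnorm2 B * ((1 + cs) * \<Delta> + ?F)"
    using mB by (simp add: c3t c4t c5t_eq field_simps)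
  finally have R: "?R \<le> mnorm2 B * ((1 + cs) * \<Delta> + ?F)" .
  have R0: "0 \<le> ?R"
    using cs n0 mA by (auto intro!: add_nonneg_nonneg mult_nonneg_nonneg simp: S_def T_def)
  have "matrix_inv B *v (B *v xh - b) = xh - x"
    using matrix_inv_mult_vector[OF B_nonsing]
    by (simp flip: x_exact add: matrix_vector_mult_diff_distrib)
  then have "\<Delta> \<le> mnorm2 (matrix_inv B) * norm (B *v xh - b)"
    using norm_matrix_vector_le_mnorm2[of "matrix_inv B" "B *v xh - b"] by (simp add: \<Delta>_def)
  also have "\<dots> \<le> mnorm2 (matrix_inv B) * (eps * (1 / (1 - 2 * t)) * (mnorm2 B * ((1 + cs) * \<Delta> + ?F)))"
  proof (rule mult_left_mono)
    note res
    also have "eps * H * ?R \<le> eps * (1 / (1 - 2 * t)) * (mnorm2 B * ((1 + cs) * \<Delta> + ?F))"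
      using H R R0 eps_pos t2 by (intro mult_mono mult_left_mono) auto
    finally show "norm (B *v xh - b) \<le> \<dots>" .
  qed (rule mnorm2_nonneg)
  also have "\<dots> = E * ((1 + cs) * \<Delta> + ?F) / (1 - 2 * t)"
    by (simp add: E_def kappa2_def)
  finally have "\<Delta> * (1 - 2 * t) \<le> E * ((1 + cs) * \<Delta> + ?F)"
    using t2 by (simp add: pos_le_divide_eq)
  then have "\<Delta> * K \<le> E * ?F"
    by (simp add: K_def algebra_simps)
  then have "\<Delta> \<le> E * ?F / K"
    using K by (simp add: pos_le_divide_eq)
  also have "\<dots> = E / (1 - c3 * E) * (c3 * norm xh + c4 * norm ph + c5 * T)"
  proof -
    \<comment> \<open>The constants \<open>c3\<close>, \<open>c4\<close>, \<open>c5\<close> and the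
      outer denominator \<open>1 - c3 * E\<close> all carry the denominator \<open>1 - t\<close>,
      which cancels.\<close>
    have "c3 * norm xh + c4 * norm ph + c5 * T = ?F / (1 - t)"
    proof -
      have "eps * c3t * kappa2 B = t"
        by (simp add: t_def E_def)
      then show ?thesis
        unfolding c3_eq c4_eq c5_eq by (simp add: add_divide_distrib[symmetric])
    qed
    moreover have "1 - c3 * E = K / (1 - t)"
      using t1 unfolding c3E K_def by (simp add: t_def field_simps)
    ultimately show ?thesis
      using t1 by simp
  qed
  finally show ?thesis
    by (simp add: \<Delta>_def E_def T_def mult_ac)
qed

end
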